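(* Let $K\subset\mathbb{R}^n$ be a polyhedral cone with normalized conic base $B_K=\{u^1,\ldots,u^p\}$ ($p\ge1$), so that $K=\operatorname{cone}(B_K)$, and let $d:=-P_{\operatorname{aff}(B_K)}(0)$ be its circumcentric direction. Suppose $d\ne0$, and set $a:=-d/\|d\|$ and $\theta:=\arccos\|d\|\in[0,\pi/2]$. Fix $w\in\mathbb{R}^n$ with $\|w\|=1$ and write $\phi:=\arccos\langle w,a\rangle\in[0,\pi]$. Then $$\max_{1\le i\le p}\langle w,u^i\rangle\le\cos(\phi-\theta),$$ and consequently, with $\rho_K(w):=\sup\{t\ge0:d+tw\in K^\circ\}\in[0,+\infty]$, $$\rho_K(w)\ge\frac{\cos^2\theta}{[\cos(\phi-\theta)]_+},$$ where $[t]_+=\max\{t,0\}$, and $\rho_K(w)=+\infty$ when $\phi-\theta\ge\pi/2$.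
   Context: $\langle\cdot,\cdot\rangle$ and $\|\cdot\|$ are the Euclidean inner product and norm on $\mathbb{R}^n$. The normalized conic base $B_K=\{u^1,\ldots,u^p\}$ of a polyhedral cone $K$ is the finite set of unit vectors along the extreme rays of $K$. The polar cone is $K^\circ=\{w\in\mathbb{R}^n:\langle w,z\rangle\le0\ \text{for all }z\in K\}$. $\operatorname{aff}(B_K)$ is the affine hull and $P_{\operatorname{aff}(B_K)}(0)$ is the orthogonal projection of the origin onto it (this is the circumcenter of $B_K$). The quotient $\cos^2\theta/[\cos(\phi-\theta)]_+$ is read as $+\infty$ when its denominator is $0$. *)

theory Defs
  imports "HOL-Analysis.Analysis"
begin

(* An extreme ray is a face that is a half-line emanating from the origin. *)
definition conic_base :: "(real ^ 'n) set \<Rightarrow> (real ^ 'n) set" where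
  "conic_base K = {u. norm u = 1 \<and> {t *\<^sub>R u | t. 0 \<le> t} face_of K}"

(* Makes Max over a conic base meaningful. *)
lemma finite_conic_base:
  fixes K :: "(real ^ 'n) set"
  assumes "polyhedron K"
  shows "finite (conic_base K)"
proof (rule finite_imageD)
  let ?ray = "\<lambda>u :: real ^ 'n. {t *\<^sub>R u | t. 0 \<le> t}"
  show "finite (?ray ` conic_base K)"
    by (rule finite_subset [OF _ finite_polyhedron_faces [OF assms]])
       (auto simp: conic_base_def)
  show "inj_on ?ray (conic_base K)"
  proof (rule inj_onI)
    fix u v
    assume u: "u \<in> conic_base K" and v: "v \<in> conic_base K" and eq: "?ray u = ?ray v"
    have "u \<in> ?ray u"
      by (rule CollectI, rule exI [of _ 1]) simp
    then obtain t where t: "0 \<le> t" "u = t *\<^sub>R v"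
      using eq by auto
    then show "u = v"
      using u v by (auto simp: conic_base_def)
  qed
qed

definition polar_cone :: "(real ^ 'n) set \<Rightarrow> (real ^ 'n) set" where
  "polar_cone K = {w. \<forall>z\<in>K. w \<bullet> z \<le> 0}"

definition circumcentric_direction :: "(real ^ 'n) set \<Rightarrow> real ^ 'n" where
  "circumcentric_direction K = - closest_point (affine hull (conic_base K)) 0"

(* Supremum in the extended reals, so that an unbounded set of steps gives \<infinity>. *)
definition rho :: "(real ^ 'n) set \<Rightarrow> real ^ 'n \<Rightarrow> ereal" where
  "rho K w = (SUP t \<in> {t. 0 \<le> t \<and> circumcentric_direction K + t *\<^sub>R w \<in> polar_cone K}. ereal t)"

(* Quotient with the convention x / 0 = \<infinity>, unlike division on real. *)
definition ext_quotient :: "real \<Rightarrow> real \<Rightarrow> ereal" where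
  "ext_quotient x y = (if y = 0 then \<infinity> else ereal (x / y))"

end

theory Submission
  imports Defs
begin

text \<open>
  Since \<open>-d\<close> is the projection of the origin onto the affine hull of the conic base, every
  generator \<open>u\<close> satisfies \<open>d \<bullet> u = - cos\<^sup>2 \<theta>\<close>, i.e. makes the angle \<open>\<theta>\<close> with \<open>a\<close>. The spherical
  triangle inequality for \<open>w\<close>, \<open>a\<close>, \<open>u\<close> bounds \<open>w \<bullet> u\<close> by \<open>cos (\<phi> - \<theta>)\<close>, so the step \<open>t\<close> is
  admissible as soon as \<open>t * cos (\<phi> - \<theta>) \<le> cos\<^sup>2 \<theta>\<close>.
\<close>

text \<open>Projection onto a convex set gives only an obtuse-angle inequality. An affine set also
  contains the reflection \<open>2 *\<^sub>R ?c - x\<close> of \<open>x\<close> through the closest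
  point, and the inequality there is the reverse one.\<close>

lemma closest_point_affine_orthogonal:
  fixes x z :: "'a::euclidean_space"
  assumes "affine S" "x \<in> S"
  shows "(z - closest_point S z) \<bullet> (x - closest_point S z) = 0"
proof -
  let ?c = "closest_point S z"
  have S: "closed S" "convex S"
    using assms by (auto simp: affine_closed affine_imp_convex)
  have c: "?c \<in> S"
    using S assms by (auto intro: closest_point_in_set)
  have "(1 - 2) *\<^sub>R x + 2 *\<^sub>R ?c \<in> S"
    by (rule mem_affine [OF assms c]) simp
  then have "(z - ?c) \<bullet> (((1 - 2) *\<^sub>R x + 2 *\<^sub>R ?c) - ?c) \<le> 0"
    using closest_point_dot S by blast
  moreover have "(z - ?c) \<bullet> (x - ?c) \<le> 0"
    using closest_point_dot S assms by blast
  ultimately show ?thesis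
    by (simp add: inner_diff_right inner_add_right)
qed

text \<open>Split \<open>u\<close> and \<open>w\<close> into their parts along \<open>a\<close> and
  orthogonal to \<open>a\<close>. The orthogonal parts have the sines of the two angles as norms, so
  Cauchy-Schwarz on them and the cosine subtraction formula give the bound.\<close>

lemma inner_le_cos_arccos_diff:
  fixes u w a :: "'a::real_inner"
  assumes "norm u = 1" "norm w = 1" "norm a = 1"
  shows "u \<bullet> w \<le> cos (arccos (u \<bullet> a) - arccos (w \<bullet> a))"
proof -
  define pu where "pu = u - (u \<bullet> a) *\<^sub>R a"
  define pw where "pw = w - (w \<bullet> a) *\<^sub>R a"
  have sq: "u \<bullet> u = 1" "w \<bullet> w = 1" "a \<bullet> a = 1"
    using assms by (simp_all add: dot_square_norm)
  have bounds: "\<bar>u \<bullet> a\<bar> \<le> 1" "\<bar>w \<bullet> a\<bar> \<le> 1"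
    using Cauchy_Schwarz_ineq2[of u a] Cauchy_Schwarz_ineq2[of w a] assms by simp_all
  have "norm pu = sqrt (1 - (u \<bullet> a)\<^sup>2)" "norm pw = sqrt (1 - (w \<bullet> a)\<^sup>2)"
    by (simp_all add: norm_eq_sqrt_inner pu_def pw_def inner_diff_left inner_diff_right sq
        inner_commute power2_eq_square)
  then have norms: "norm pu = sin (arccos (u \<bullet> a))" "norm pw = sin (arccos (w \<bullet> a))"
    using bounds by (simp_all add: sin_arccos_abs)
  have "u \<bullet> w = (u \<bullet> a) * (w \<bullet> a) + pu \<bullet> pw"
    by (simp add: pu_def pw_def inner_diff_left inner_diff_right sq inner_commute)
  also have "\<dots> \<le> (u \<bullet> a) * (w \<bullet> a) + norm pu * norm pw"
    by (simp add: norm_cauchy_schwarz)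
  also have "\<dots> = cos (arccos (u \<bullet> a) - arccos (w \<bullet> a))"
    using bounds norms by (simp add: cos_diff cos_arccos_abs)
  finally show ?thesis .
qed

text \<open>Polarity can be tested on generators: the half-space of all \<open>z\<close> with
  \<open>v \<bullet> z \<le> 0\<close> is itself a convex cone, so it contains the hull.\<close>

lemma mem_polar_cone_convex_cone_hull:
  assumes "\<And>u. u \<in> B \<Longrightarrow> v \<bullet> u \<le> 0"
  shows "v \<in> polar_cone (convex_cone hull B)"
proof -
  have "convex_cone hull B \<subseteq> {z. v \<bullet> z \<le> 0}"
    using assms by (intro hull_minimal convex_cone_halfspace_le) auto
  then show ?thesis
    by (auto simp: polar_cone_def)
qed

lemma circumcentric_direction_inner:
  assumes "u \<in> conic_base K"
  shows "circumcentric_direction K \<bullet> u = - (norm (circumcentric_direction K))\<^sup>2"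
  using closest_point_affine_orthogonal [OF affine_affine_hull hull_inc [OF assms], of 0]
  by (simp add: circumcentric_direction_def inner_diff_right dot_square_norm)

text \<open>Ensures that \<open>arccos (norm d)\<close> is a genuine angle with cosine
  \<open>norm d\<close>. Cauchy-Schwarz against any unit generator bounds the square of the norm by
  the norm itself.\<close>

lemma norm_circumcentric_direction_le_1:
  assumes "conic_base K \<noteq> {}"
  shows "norm (circumcentric_direction K) \<le> 1"
proof -
  obtain u where u: "u \<in> conic_base K"
    using assms by blast
  let ?d = "circumcentric_direction K"
  have "(norm ?d)\<^sup>2 \<le> norm ?d * norm u"
    using circumcentric_direction_inner [OF u] Cauchy_Schwarz_ineq2 [of ?d u] by simp
  then have "norm ?d * norm ?d \<le> norm ?d * 1"
    using u by (simp add: conic_base_def power2_eq_square)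
  then show ?thesis
    by (cases "?d = 0") auto
qed

lemma le_rho:
  assumes "0 \<le> t" "circumcentric_direction K + t *\<^sub>R w \<in> polar_cone K"
  shows "ereal t \<le> rho K w"
  unfolding rho_def by (rule SUP_upper) (use assms in simp)

theorem corollary5p2:
  fixes K :: "(real ^ 'n) set" and d a w :: "real ^ 'n" and \<theta> \<phi> :: real
  assumes "polyhedron K" and "convex_cone K"
    and "conic_base K \<noteq> {}"
    and "K = convex_cone hull (conic_base K)"
    and "d = circumcentric_direction K"
    and "d \<noteq> 0"
    and "a = - (d /\<^sub>R norm d)"
    and "\<theta> = arccos (norm d)"
    and "norm w = 1"
    and "\<phi> = arccos (w \<bullet> a)"
  shows "\<theta> \<in> {0..pi/2} \<and> \<phi> \<in> {0..pi} \<and>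
    Max ((\<lambda>u. w \<bullet> u) ` conic_base K) \<le> cos (\<phi> - \<theta>) \<and>
    rho K w \<ge> ext_quotient ((cos \<theta>)\<^sup>2) (max (cos (\<phi> - \<theta>)) 0) \<and>
    (\<phi> - \<theta> \<ge> pi/2 \<longrightarrow> rho K w = \<infinity>)"
proof -
  have d1: "norm d \<le> 1"
    using norm_circumcentric_direction_le_1 assms(3,5) by blast
  have a1: "norm a = 1"
    using assms(6,7) by simp
  have \<theta>: "\<theta> \<in> {0..pi/2}" and cos_\<theta>: "cos \<theta> = norm d"
    using d1 arccos_lbound [of "norm d"] arccos_le_pi2 [of "norm d"] norm_ge_zero [of d]
    by (auto simp: assms(8) cos_arccos_abs simp del: norm_ge_zero)
  have "\<bar>w \<bullet> a\<bar> \<le> 1"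
    using Cauchy_Schwarz_ineq2[of w a] assms(9) a1 by simp
  then have \<phi>: "\<phi> \<in> {0..pi}"
    by (auto simp: assms(10) arccos_lbound arccos_ubound)
  have du: "d \<bullet> u = - (cos \<theta>)\<^sup>2" if "u \<in> conic_base K" for u
    using circumcentric_direction_inner [OF that] by (simp add: assms(5) [symmetric] cos_\<theta>)
  have wu: "w \<bullet> u \<le> cos (\<phi> - \<theta>)" if u: "u \<in> conic_base K" for u
  proof -
    \<comment> \<open>Hence \<open>arccos (u \<bullet> a)\<close> is \<open>\<theta>\<close> for
      every generator. Below, \<open>w\<close> takes the first place in the angle bound so that the
      difference appears as \<open>\<phi> - \<theta>\<close>.\<close>
    have "u \<bullet> a = norm d"
      using du [OF u] assms(6) by (simp add: assms(7) cos_\<theta> inner_commute power2_eq_square)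
    then show ?thesis
      using inner_le_cos_arccos_diff [of w u a] u a1 assms(8,9,10) by (simp add: conic_base_def)
  qed
  have step: "ereal t \<le> rho K w" if "0 \<le> t" "t * cos (\<phi> - \<theta>) \<le> (cos \<theta>)\<^sup>2" for t
  proof -
    have "(d + t *\<^sub>R w) \<bullet> u \<le> 0" if "u \<in> conic_base K" for u
      using du [OF that] mult_left_mono [OF wu [OF that] \<open>0 \<le> t\<close>] \<open>t * _ \<le> _\<close>
      by (simp add: inner_add_left)
    then have "d + t *\<^sub>R w \<in> polar_cone K"
      using mem_polar_cone_convex_cone_hull [of "conic_base K"] assms(4) by simp
    then show ?thesis
      using le_rho that(1) assms(5) by blast
  qed
  have inf: "rho K w = \<infinity>" if "cos (\<phi> - \<theta>) \<le> 0"
  proof (rule ereal_top)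
    fix B :: real
    \<comment> \<open>With a nonpositive cosine every step length \<open>t \<ge> 0\<close> is
      admissible. The bound \<open>B\<close> may be negative, so it is truncated at 0 to become a
      step length.\<close>
    have "max B 0 * cos (\<phi> - \<theta>) \<le> (cos \<theta>)\<^sup>2"
      using mult_nonneg_nonpos [OF _ that, of "max B 0"] zero_le_power2 [of "cos \<theta>"] by linarith
    then have "ereal (max B 0) \<le> rho K w"
      by (intro step) simp_all
    then show "ereal B \<le> rho K w"
      by (rule order_trans [rotated]) simp
  qed
  have "Max ((\<lambda>u. w \<bullet> u) ` conic_base K) \<le> cos (\<phi> - \<theta>)"
    using finite_conic_base [OF assms(1)] assms(3) wu by simp
  moreover have "rho K w \<ge> ext_quotient ((cos \<theta>)\<^sup>2) (max (cos (\<phi> - \<theta>)) 0)"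
  proof (cases "cos (\<phi> - \<theta>) \<le> 0")
    case True
    then show ?thesis
      using inf by simp
  next
    case False
    \<comment> \<open>The denominator is now positive, so the extended quotient is the ordinary one,
      which is the largest step that the criterion admits.\<close>
    then show ?thesis
      using step [of "(cos \<theta>)\<^sup>2 / cos (\<phi> - \<theta>)"] by (simp add: ext_quotient_def max_def)
  qed
  moreover have "rho K w = \<infinity>" if "\<phi> - \<theta> \<ge> pi/2"
  proof (rule inf)
    \<comment> \<open>Since \<open>\<phi> \<le> pi\<close> and \<open>\<theta> \<ge> 0\<close>, the
      difference stays at most \<open>pi\<close>, where cosine is still decreasing.\<close>
    have "cos (\<phi> - \<theta>) \<le> cos (pi/2)"
      using that \<theta> \<phi> by (intro cos_monotone_0_pi_le) auto
    then show "cos (\<phi> - \<theta>) \<le> 0"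
      by simp
  qed
  ultimately show ?thesis
    using \<theta> \<phi> by blast
qed

end
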